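(* Let $p\geq 1$ be an odd natural number. Define the double-indexed sequence $A_r(k)$ for integers $r,k\ge0$ by $A_r(0)=1$ for all $r$, and for $k\ge1$ $$A_r(k)=(p-r-k)\,A_r(k-1)+4\,(p-2r)\,A_{r+1}(k-1).$$ Then $$2^p-1=\frac{A_0(\lfloor p/2\rfloor)}{(p-1)(p-2)\cdots(p-\lfloor p/2\rfloor)} .$$
   Context: Empty products equal $1$. *)

theory Defs
  imports Complex_Main
begin

(* A p r k is A_r(k) for the parameter p. The values are integers, as the
   coefficients p - r - k and p - 2r may be negative. *)
fun A :: "nat \<Rightarrow> nat \<Rightarrow> nat \<Rightarrow> int" where
  "A p r 0 = 1"
| "A p r (Suc k) =
     (int p - int r - int (Suc k)) * A p r k + 4 * (int p - 2 * int r) * A p (Suc r) k"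

end

theory Submission
  imports Defs
begin

text \<open>
  Unfolding the recursion over all paths of \<open>k\<close> steps, \<open>j\<close> of which raise \<open>r\<close>, the weight
  of a path depends only on \<open>j\<close>, so \<open>A\<^sub>r(k)\<close> is a single sum over \<open>j\<close>. For \<open>p = 2m + 1\<close>, \<open>r = 0\<close>,
  \<open>k = m\<close>, division by the denominator leaves a hypergeometric sum \<open>S(m)\<close>, and Zeilberger's
  method yields \<open>S(m + 2) - 5 S(m + 1) + 4 S(m) = 0\<close>. Its solutions are spanned by \<open>4\<^sup>m\<close> and \<open>1\<close>.
\<close>

text \<open>At \<open>(r, k)\<close> a staying step has weight \<open>p - r - k\<close> and lowers
  \<open>r + k\<close> by one; a raising step has weight \<open>p - 2r\<close> and preserves
  \<open>r + k\<close>. So in any order of the steps the staying factors go up by 1 and the raising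
  factors go down by 2, and \<open>k choose j\<close> counts the orders.\<close>

lemma A_closed_form:
  "A p r k = (\<Sum>j\<le>k. of_nat (k choose j) * 4 ^ j * (\<Prod>i<j. int p - 2 * int r - 2 * int i)
      * (\<Prod>s<k - j. int p - int r - int k + int s))"
proof (induction k arbitrary: r)
  case 0
  then show ?case by simp
next
  case (Suc k)
  define P where "P j = (\<Prod>i<j. int p - 2 * int r - 2 * int i)" for j
  define Q where "Q n = (\<Prod>s<n. int p - int r - int (Suc k) + int s)" for n
  \<comment> \<open>Weight of one path with \<open>j\<close> raises among \<open>Suc k\<close>
    steps. The first factor of \<open>Q\<close> is the coefficient of an initial staying step, that
    of \<open>P\<close> belongs to an initial raise.\<close>
  define f where "f j = 4 ^ j * P j * Q (Suc k - j)" for j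
  have stay: "(int p - int r - int (Suc k)) * A p r k = (\<Sum>j\<le>k. of_nat (k choose j) * f j)"
    unfolding Suc.IH sum_distrib_left
  proof (rule sum.cong[OF refl])
    fix j assume "j \<in> {..k}"
    then have "Q (Suc k - j)
        = (int p - int r - int (Suc k)) * (\<Prod>s<k - j. int p - int r - int k + int s)"
      by (simp add: Q_def Suc_diff_le prod.lessThan_Suc_shift algebra_simps del: prod.lessThan_Suc)
    then show "(int p - int r - int (Suc k)) * (of_nat (k choose j) * 4 ^ j *
        (\<Prod>i<j. int p - 2 * int r - 2 * int i) * (\<Prod>s<k - j. int p - int r - int k + int s))
        = of_nat (k choose j) * f j"
      by (simp add: f_def P_def)
  qed
  have raise: "4 * (int p - 2 * int r) * A p (Suc r) k
      = (\<Sum>j\<le>k. of_nat (k choose j) * f (Suc j))"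
    unfolding Suc.IH sum_distrib_left
  proof (rule sum.cong[OF refl])
    fix j assume "j \<in> {..k}"
    have "P (Suc j) = (int p - 2 * int r) * (\<Prod>i<j. int p - 2 * int (Suc r) - 2 * int i)"
      by (simp add: P_def prod.lessThan_Suc_shift algebra_simps del: prod.lessThan_Suc)
    moreover have "Q (k - j) = (\<Prod>s<k - j. int p - int (Suc r) - int k + int s)"
      by (simp add: Q_def algebra_simps)
    ultimately show "4 * (int p - 2 * int r) * (of_nat (k choose j) * 4 ^ j *
        (\<Prod>i<j. int p - 2 * int (Suc r) - 2 * int i) *
        (\<Prod>s<k - j. int p - int (Suc r) - int k + int s))
        = of_nat (k choose j) * f (Suc j)"
      by (simp add: f_def)
  qed
  \<comment> \<open>Pascal's rule; in the first sum on the right the term \<open>j = Suc k\<close>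
    vanishes.\<close>
  have "(\<Sum>j\<le>Suc k. of_nat (Suc k choose j) * f j)
      = (\<Sum>j\<le>Suc k. of_nat (k choose j) * f j) + (\<Sum>j\<le>k. of_nat (k choose j) * f (Suc j))"
    by (simp add: sum.atMost_Suc_shift algebra_simps sum.distrib del: sum.atMost_Suc)
  also have "\<dots> = A p r (Suc k)"
    using stay raise by simp
  finally show ?case
    by (simp add: f_def P_def Q_def mult.assoc)
qed

text \<open>For \<open>j \<le> m\<close>, the \<open>j\<close>-th summand of \<open>A p 0 m\<close>
  with \<open>p = 2m + 1\<close>, divided by \<open>2m (2m - 1) ... (m + 1)\<close>: the staying
  factors cancel the last \<open>m - j\<close> factors.\<close>

definition T :: "nat \<Rightarrow> nat \<Rightarrow> real" where
  "T m j = of_nat (m choose j) * 4 ^ j * (\<Prod>i<j. (2 * real m + 1 - 2 * real i) / (2 * real m - real i))"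

lemma T_eq_0: "m < j \<Longrightarrow> T m j = 0"
  by (simp add: T_def)

lemma T_Suc_right:
  "T m (Suc j) = T m j * 4 * (real m - real j) / (real j + 1)
     * ((2 * real m + 1 - 2 * real j) / (2 * real m - real j))"
proof -
  have "real (m choose Suc j) = real (m choose j) * (real m - real j) / (real j + 1)"
  proof (cases "j \<le> m")
    case True
    have "Suc j * (m choose Suc j) = (m - j) * (m choose j)"
      by (metis binomial_absorb_comp binomial_absorption)
    then have "real (Suc j * (m choose Suc j)) = real ((m - j) * (m choose j))"
      by (simp only:)
    then show ?thesis using True by (simp add: field_simps)
  qed (simp add: binomial_eq_0)
  then show ?thesis by (simp add: T_def)
qed

text \<open>The term ratio in \<open>m\<close>, multiplied out so that it survives at
  \<open>j = Suc m\<close>, where \<open>T m j\<close> and the factor \<open>m + 1 - j\<close> both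
  vanish. For \<open>j \<le> m\<close>, induction on \<open>j\<close> compares the ratios in
  \<open>j\<close> of the two sides.\<close>

lemma T_Suc_left:
  "T m j * ((2 * real m + 2 - real j) * (2 * real m + 1 - real j) * (2 * real m + 3))
     = T (Suc m) j * ((real m + 1 - real j) * (2 * real m + 3 - 2 * real j) * 2 * (2 * real m + 1))"
proof (cases "j \<le> m")
  case True
  then show ?thesis
  proof (induction j)
    case 0
    then show ?case by (simp add: T_def algebra_simps)
  next
    case (Suc j)
    define x y where "x = real m" and "y = real j"
    have "j + 1 \<le> m" using Suc.prems by simp
    then have le: "y + 1 \<le> x" by (simp add: x_def y_def)
    have y0: "0 \<le> y" by (simp add: y_def)
    define c where "c = (2 * x + 2 - y) * (2 * x + 1 - y) * (2 * x + 3)"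
    have c: "c \<noteq> 0" using le y0 by (auto simp: c_def)
    have IH: "T m j = T (Suc m) j * ((x + 1 - y) * (2 * x + 3 - 2 * y) * 2 * (2 * x + 1)) / c"
      using Suc c by (simp add: x_def y_def c_def field_simps)
    have nz: "2 * x - y \<noteq> 0" "2 * x + 2 - y \<noteq> 0" "2 * x + 1 - y \<noteq> 0" "y + 1 \<noteq> 0" "2 * x + 3 \<noteq> 0"
      using le y0 by auto
    have left: "T m (Suc j) = T m j * 4 * (x - y) / (y + 1) * ((2 * x + 1 - 2 * y) / (2 * x - y))"
      by (simp add: T_Suc_right x_def y_def)
    have right: "T (Suc m) (Suc j) = T (Suc m) j * 4 * (x + 1 - y) / (y + 1)
        * ((2 * x + 3 - 2 * y) / (2 * x + 2 - y))"
      by (simp add: T_Suc_right x_def y_def algebra_simps)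
    have "T m (Suc j) * ((2 * x + 1 - y) * (2 * x - y) * (2 * x + 3))
        = T (Suc m) (Suc j) * ((x - y) * (2 * x + 1 - 2 * y) * 2 * (2 * x + 1))"
      unfolding left right IH c_def using nz by (simp add: divide_simps)
    then show ?case by (simp add: x_def y_def algebra_simps)
  qed
next
  case False
  then have "j = Suc m \<or> Suc m < j" by auto
  then show ?thesis by (auto simp: T_eq_0)
qed

text \<open>The Wilf--Zeilberger certificate of the recurrence, found by interpolating partial sums.\<close>

definition G :: "nat \<Rightarrow> nat \<Rightarrow> real" where
  "G m j = (let x = real m; y = real j in
     T (m + 2) j * y
       * ((6 + 94*x + 252*x^2 + 200*x^3 + 48*x^4) - (15 + 214*x + 424*x^2 + 264*x^3 + 48*x^4) * y
          + (12 + 152*x + 192*x^2 + 64*x^3) * y^2 - (3 + 32*x + 20*x^2) * y^3)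
       / ((2*x + 3) * (2*x + 5) * (2*x + 4 - y) * (2*x + 3 - y) * (2*x + 2 - y) * (2*x + 1 - y)))"

text \<open>Every term is a rational multiple of \<open>T (m + 2) j\<close>, so clearing
  denominators leaves a polynomial identity. The assumptions keep the denominators positive; the
  critical one is \<open>2m - j \<ge> m - 2\<close>.\<close>

lemma T_telescoping:
  assumes "3 \<le> m" "j \<le> m + 2"
  shows "T (m + 2) j - 5 * T (m + 1) j + 4 * T m j = G m (Suc j) - G m j"
proof -
  define x y where "x = real m" and "y = real j"
  have "real j \<le> real (m + 2)" using assms(2) by (rule of_nat_mono)
  then have le: "y \<le> x + 2" by (simp add: x_def y_def)
  have x3: "3 \<le> x" using assms by (simp add: x_def)
  have y0: "0 \<le> y" by (simp add: y_def)
  define t where "t = T (m + 2) j"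
  define a b c d e u v w where abc: "a = 2*x + 4 - y" "b = 2*x + 3 - y" "c = 2*x + 2 - y"
    "d = 2*x + 1 - y" "e = 2*x - y" "u = 2*x + 3" "v = 2*x + 5" "w = y + 1"
  have nz: "a \<noteq> 0" "b \<noteq> 0" "c \<noteq> 0" "d \<noteq> 0" "e \<noteq> 0" "u \<noteq> 0" "v \<noteq> 0" "w \<noteq> 0"
    using le x3 y0 by (auto simp: abc)
  define q where "q z = (6 + 94*x + 252*x^2 + 200*x^3 + 48*x^4)
      - (15 + 214*x + 424*x^2 + 264*x^3 + 48*x^4) * z
      + (12 + 152*x + 192*x^2 + 64*x^3) * z^2 - (3 + 32*x + 20*x^2) * z^3" for z
  define h k where hk: "h = (x + 2 - y) * (2*x + 5 - 2*y)"
    "k = (x + 1 - y) * (2*x + 3 - 2*y) * (2*x + 1)"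
  have T1: "T (m + 1) j = t * (2 * h * u) / (a * b * v)"
  proof -
    have "T (m + 1) j * (a * b * v) = t * (2 * h * u)"
      using T_Suc_left[of "m + 1" j] by (simp add: t_def abc hk x_def y_def algebra_simps)
    then show ?thesis using nz by (simp add: eq_divide_eq)
  qed
  have T0: "T m j = t * (2 * h * u) / (a * b * v) * (2 * k) / (c * d * u)"
  proof -
    have "T m j * (c * d * u) = T (m + 1) j * (2 * k)"
      using T_Suc_left[of m j] by (simp add: abc hk x_def y_def algebra_simps)
    then show ?thesis using nz by (simp add: eq_divide_eq flip: T1)
  qed
  have TS: "T (m + 2) (Suc j) = t * 4 * h / (w * a)"
  proof -
    have "T (m + 2) (Suc j) = t * 4 * (x + 2 - y) / w * ((2*x + 5 - 2*y) / a)"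
      by (simp add: T_Suc_right t_def abc x_def y_def algebra_simps)
    then show ?thesis by (simp add: hk mult_ac)
  qed
  have G0: "G m j = t * y * q y / (u * v * a * b * c * d)"
    by (simp add: G_def Let_def q_def t_def abc x_def y_def)
  \<comment> \<open>Passing from \<open>j\<close> to \<open>j + 1\<close> turns
    \<open>a, b, c, d\<close> into \<open>b, c, d, e\<close> and \<open>y\<close> into
    \<open>w\<close>, which cancels the \<open>w\<close> in \<open>TS\<close>.\<close>
  have "G m (Suc j) = T (m + 2) (Suc j) * w * q w / (u * v * b * c * d * e)"
    by (simp add: G_def Let_def q_def abc x_def y_def algebra_simps)
  then have G1: "G m (Suc j) = t * 4 * h * q w / (u * v * a * b * c * d * e)"
    unfolding TS using nz by (simp add: mult_ac)
  \<comment> \<open>Numerator of the left-hand side over \<open>u * v * a * b * c * d\<close>; the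
    further factor \<open>e\<close> comes from \<open>G m (Suc j)\<close>.\<close>
  define L where "L = a * b * c * d * u * v - 10 * h * u * u * c * d + 16 * h * k * u"
  have "L * e = 4 * h * q w - y * q y * e"
    unfolding L_def q_def abc hk by algebra
  moreover have "T (m + 2) j - 5 * T (m + 1) j + 4 * T m j = t * (L * e) / (u * v * a * b * c * d * e)"
    unfolding T0 T1 t_def[symmetric] L_def using nz by (simp add: field_simps)
  moreover have "G m (Suc j) - G m j
      = t * (4 * h * q w - y * q y * e) / (u * v * a * b * c * d * e)"
    unfolding G0 G1 using nz by (simp add: diff_divide_distrib right_diff_distrib)
  ultimately show ?thesis by simp
qed

definition S :: "nat \<Rightarrow> real" where
  "S m = (\<Sum>j\<le>m. T m j)"

lemma S_extend: "m \<le> n \<Longrightarrow> (\<Sum>j\<le>n. T m j) = S m"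
  unfolding S_def by (rule sum.mono_neutral_right) (auto simp: T_eq_0)

lemma S_recurrence:
  assumes "3 \<le> m"
  shows "S (m + 2) - 5 * S (m + 1) + 4 * S m = 0"
proof -
  have "S (m + 2) - 5 * S (m + 1) + 4 * S m
      = (\<Sum>j\<le>m + 2. T (m + 2) j - 5 * T (m + 1) j + 4 * T m j)"
    using S_extend[of "m + 2" "m + 2"] S_extend[of "m + 1" "m + 2"] S_extend[of m "m + 2"]
    by (simp only: sum.distrib sum_subtractf flip: sum_distrib_left)
  also have "\<dots> = (\<Sum>j\<le>m + 2. G m (Suc j) - G m j)"
    using assms by (intro sum.cong refl T_telescoping) auto
  also have "\<dots> = (\<Sum>j<Suc (m + 2). G m (Suc j) - G m j)"
    by (simp only: lessThan_Suc_atMost)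
  also have "\<dots> = G m (Suc (m + 2)) - G m 0"
    by (rule sum_lessThan_telescope)
  \<comment> \<open>\<open>T (m + 2) (m + 3) = 0\<close> at the upper end; \<open>G m 0\<close>
    contains the factor \<open>y = 0\<close>.\<close>
  also have "\<dots> = 0"
    by (simp add: G_def T_eq_0)
  finally show ?thesis .
qed

lemma S_eq: "S m = 2 ^ (2 * m + 1) - 1"
proof (induction m rule: less_induct)
  case (less m)
  \<comment> \<open>The recurrence starts at index 3 and thus yields the values for
    \<open>m \<ge> 5\<close>; the first five are computed.\<close>
  consider "m = 0" | "m = 1" | "m = 2" | "m = 3" | "m = 4" | "5 \<le> m" by linarith
  then show ?case
  proof cases
    case 6
    define n where "n = m - 2"
    have m: "m = n + 2" and n: "3 \<le> n" using 6 by (auto simp: n_def)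
    have "S n = 2 ^ (2 * n + 1) - 1" "S (n + 1) = 2 ^ (2 * (n + 1) + 1) - 1"
      using less.IH by (simp_all add: m)
    then show ?thesis using S_recurrence[OF n] by (simp add: m)
  qed (simp_all add: S_def T_def numeral_eq_Suc lessThan_Suc)
qed

theorem theorem11:
  fixes p :: nat
  assumes "p \<ge> 1" and "odd p"
  shows "(2::real) ^ p - 1 =
    of_int (A p 0 (p div 2)) / (\<Prod>i = 1..p div 2. real p - real i)"
proof -
  obtain m where p: "p = 2 * m + 1" using assms(2) by (rule oddE)
  define D where "D = (\<Prod>i<m. 2 * real m - real i)"
  have D: "(\<Prod>i = 1..p div 2. real p - real i) = D"
    unfolding D_def by (rule prod.reindex_bij_witness[of _ Suc "\<lambda>i. i - 1"]) (auto simp: p)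
  have D0: "D \<noteq> 0" by (auto simp: D_def)
  have "real_of_int (A p 0 m) = (\<Sum>j\<le>m. T m j * D)"
    unfolding A_closed_form of_int_sum
  proof (rule sum.cong[OF refl])
    fix j assume "j \<in> {..m}"
    then have j: "j \<le> m" by simp
    have nz: "(\<Prod>i<j. 2 * real m - real i) \<noteq> 0" using j by auto
    \<comment> \<open>With \<open>i = m - 1 - s\<close> one has \<open>p - m + s = 2m - i\<close>:
      the staying factors are the factors of \<open>D\<close> from index \<open>j\<close>
      on.\<close>
    have "(\<Prod>s<m - j. real p - real m + real s) = (\<Prod>i\<in>{j..<m}. 2 * real m - real i)"
      using j by (intro prod.reindex_bij_witness[of _ "\<lambda>i. m - 1 - i" "\<lambda>s. m - 1 - s"])
        (auto simp: p)
    then have "D = (\<Prod>i<j. 2 * real m - real i) * (\<Prod>s<m - j. real p - real m + real s)"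
      unfolding D_def using j
      by (simp add: lessThan_atLeast0 prod.atLeastLessThan_concat)
    with nz show "real_of_int (int (m choose j) * 4 ^ j * (\<Prod>i<j. int p - 2 * int 0 - 2 * int i)
        * (\<Prod>s<m - j. int p - int 0 - int m + int s)) = T m j * D"
      by (simp add: T_def prod_dividef p algebra_simps)
  qed
  also have "\<dots> = S m * D"
    by (simp add: S_def sum_distrib_right)
  finally show ?thesis
    using D D0 by (simp add: S_eq p)
qed

end
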